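(* Suppose $R^2\sim\chi^2_4$ and $U\sim\operatorname{Uniform}[0,1]$ are independent. Then $$\tfrac14R^2U^2\le_{\mathrm{st}}\chi^2_1.$$
   Context: For two random variables (or distributions) $U,V$, the stochastic order $U\le_{\mathrm{st}}V$ means $P(U>t)\le P(V>t)$ for all $t\in\mathbb{R}$. $\chi^2_d$ denotes the chi-square distribution with $d$ degrees of freedom. *)

theory Defs
  imports "HOL-Probability.Probability"
begin

text \<open>
  Density and law on the real line of the chi-square distribution with \<open>d\<close> degrees of freedom.
  The case \<open>d = 0\<close> (a point mass, without a density) is not covered: there \<open>chi_square 0\<close> is a
  meaningless value. For \<open>d > 0\<close> it is a probability measure, see \<open>prob_space_chi_square\<close>.
\<close>

definition chi_square_density :: "nat \<Rightarrow> real \<Rightarrow> real" where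
  "chi_square_density d x =
     (if x > 0
      then x powr (real d / 2 - 1) * exp (- x / 2) / (2 powr (real d / 2) * Gamma (real d / 2))
      else 0)"

definition chi_square :: "nat \<Rightarrow> real measure" where
  "chi_square d = density lborel (\<lambda>x. ennreal (chi_square_density d x))"

text \<open>The stochastic order between probability measures on the Borel sets of the real line.\<close>

definition stochastic_le :: "real measure \<Rightarrow> real measure \<Rightarrow> bool" (infix "\<le>\<^sub>s\<^sub>t" 50) where
  "\<mu> \<le>\<^sub>s\<^sub>t \<nu> \<longleftrightarrow> (\<forall>t::real. measure \<mu> {t<..} \<le> measure \<nu> {t<..})"

lemma chi_square_density_measurable [measurable]: "chi_square_density d \<in> borel_measurable borel"
  unfolding chi_square_density_def by measurable

lemma sets_chi_square [simp, measurable_cong]: "sets (chi_square d) = sets borel"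
  by (simp add: chi_square_def)

lemma prob_space_chi_square:
  assumes "d > 0"
  shows "prob_space (chi_square d)"
proof
  define a where "a = real d / 2"
  have a: "a > 0" using assms by (simp add: a_def)
  have G: "Gamma a > 0" using a by (rule Gamma_real_pos)
  define f where "f = (\<lambda>t::real. ennreal (indicator {0..} t * t powr (a - 1) / exp t))"
  have fm: "f \<in> borel_measurable borel" unfolding f_def by measurable
  have *: "ennreal (chi_square_density d (0 + 2 * t)) = ennreal (1 / (2 * Gamma a)) * f t" for t
  proof (cases "t > 0")
    case True
    have p: "(t * 2) powr (a - 1) = 2 powr a * t powr (a - 1) / 2"
      using True by (simp add: powr_mult powr_diff)
    have "chi_square_density d (0 + 2 * t)
        = (1 / (2 * Gamma a)) * (indicator {0..} t * t powr (a - 1) / exp t)"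
      using True unfolding chi_square_density_def
      by (simp add: a_def[symmetric] exp_minus field_simps) (simp add: p)
    then show ?thesis
      unfolding f_def using G True by (subst ennreal_mult[symmetric]) auto
  next
    case False
    then show ?thesis
      by (cases "t = 0") (auto simp: chi_square_density_def f_def)
  qed
  have "emeasure (chi_square d) (space (chi_square d))
      = (\<integral>\<^sup>+x. ennreal (chi_square_density d x) \<partial>lborel)"
    by (simp add: chi_square_def emeasure_density)
  also have "\<dots> = ennreal 2 * (\<integral>\<^sup>+t. ennreal (chi_square_density d (0 + 2 * t)) \<partial>lborel)"
    by (subst nn_integral_real_affine[where c = 2 and t = 0]) auto
  also have "\<dots> = ennreal 2 * (ennreal (1 / (2 * Gamma a)) * (\<integral>\<^sup>+t. f t \<partial>lborel))"
    unfolding * using fm by (subst nn_integral_cmult) auto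
  also have "(\<integral>\<^sup>+t. f t \<partial>lborel) = ennreal (Gamma a)"
    unfolding f_def using a by (rule Gamma_conv_nn_integral_real[symmetric])
  also have "ennreal 2 * (ennreal (1 / (2 * Gamma a)) * ennreal (Gamma a)) = 1"
  proof -
    have "ennreal (2 * (1 / (2 * Gamma a) * Gamma a)) = 1" using G by simp
    moreover have "ennreal (2 * (1 / (2 * Gamma a) * Gamma a))
        = ennreal 2 * (ennreal (1 / (2 * Gamma a)) * ennreal (Gamma a))"
      using G by (subst ennreal_mult, simp, simp, subst ennreal_mult) auto
    ultimately show ?thesis by simp
  qed
  finally show "emeasure (chi_square d) (space (chi_square d)) = 1" .
qed

end

theory Submission
  imports Defs "HOL-Real_Asymp.Real_Asymp"
begin

text \<open>
  Let \<open>Q t\<close> be the tail \<open>P(V > t)\<close> of a variable \<open>V\<close> with the law \<open>chi_square 1\<close>, and fix \<open>t = s\<^sup>2 > 0\<close>. Given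
  \<open>R\<^sup>2 = x\<close>, the event \<open>R\<^sup>2 U\<^sup>2 / 4 > t\<close> says \<open>U > 2 s / sqrt x\<close>, so it has conditional probability
  \<open>max 0 (1 - 2 s / sqrt x)\<close>. Integrating this against the density \<open>x exp (- x / 2) / 4\<close> of
  \<open>chi_square 4\<close> by means of an explicit antiderivative (\<open>nn_integral_chi_square_4_uniform_tail\<close>)
  gives
  \<open>P(R\<^sup>2 U\<^sup>2 / 4 > s\<^sup>2) = exp (- 2 s\<^sup>2) - sqrt (pi / 2) * s * Q (4 s\<^sup>2)\<close>.
  With \<open>G s = Q (s\<^sup>2)\<close>, the tail of a half-normal variable, the claim becomes \<open>D s \<ge> 0\<close> for
  \<open>D s = G s + sqrt (pi / 2) * s * G (2 * s) - exp (- 2 * s\<^sup>2)\<close>.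

  This inequality is \<open>half_normal_tail_inequality\<close>. One has \<open>D 0 = 0\<close>, \<open>D' 0 > 0\<close>, and \<open>D'\<close> tends to 0 at
  infinity, while \<open>D'' s\<close> is \<open>s exp (- s\<^sup>2 / 2)\<close> times \<open>sqrt (2 / pi) - 8 s exp (- 3 s\<^sup>2 / 2)\<close>. The last
  factor is negative only on an interval, because \<open>s exp (- 3 s\<^sup>2 / 2)\<close> is quasiconcave. Hence \<open>D'\<close>,
  once negative, never becomes positive again: otherwise \<open>D''\<close> would be negative, positive and
  negative again at three successive points. So \<open>D\<close> increases from 0 and then possibly decreases; in
  the decreasing range it stays nonnegative because it is bounded below by \<open>- exp (- 2 s\<^sup>2)\<close>, which
  tends to 0.
\<close>

section \<open>An inequality for the half-normal tail\<close>

lemma gaussian_times_id_quasiconcave: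
  fixes x y z :: real
  assumes "0 \<le> x" "x \<le> y" "y \<le> z"
  shows "min (x * exp (- 3/2 * x\<^sup>2)) (z * exp (- 3/2 * z\<^sup>2)) \<le> y * exp (- 3/2 * y\<^sup>2)"
proof -
  define p where "p = (\<lambda>x::real. x * exp (- 3/2 * x\<^sup>2))"
  have d: "(p has_real_derivative (1 - 3 * u\<^sup>2) * exp (- 3/2 * u\<^sup>2)) (at u)" for u
    unfolding p_def by (auto intro!: derivative_eq_intros simp: algebra_simps power2_eq_square)
  show ?thesis
  proof (cases "3 * y\<^sup>2 \<le> 1")
    case True
    have "p x \<le> p y"
    proof (rule DERIV_nonneg_imp_nondecreasing[OF assms(2)])
      fix u assume "x \<le> u" "u \<le> y"
      then have "u\<^sup>2 \<le> y\<^sup>2" using assms by (intro power_mono) auto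
      then show "\<exists>v. (p has_real_derivative v) (at u) \<and> 0 \<le> v"
        using True by (intro exI[of _ "(1 - 3 * u\<^sup>2) * exp (- 3/2 * u\<^sup>2)"] conjI d) auto
    qed
    then show ?thesis by (simp add: p_def)
  next
    case False
    have "p z \<le> p y"
    proof (rule DERIV_nonpos_imp_nonincreasing[OF assms(3)])
      fix u assume "y \<le> u" "u \<le> z"
      then have "y\<^sup>2 \<le> u\<^sup>2" using assms by (intro power_mono) auto
      then show "\<exists>v. (p has_real_derivative v) (at u) \<and> v \<le> 0"
        using False by (intro exI[of _ "(1 - 3 * u\<^sup>2) * exp (- 3/2 * u\<^sup>2)"] conjI d)
          (auto intro!: mult_nonpos_nonneg)
    qed
    then show ?thesis by (simp add: p_def)
  qed
qed

text \<open>
  The assumptions determine \<open>G\<close> on the nonnegative half-line: there it is the tail \<open>P(\<bar>Z\<bar> > s)\<close> of a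
  standard normal variable \<open>Z\<close>. In this form the Gaussian integral is not needed, since the
  normalisation enters only through the limits of \<open>G\<close> at 0 and at infinity.
\<close>

lemma half_normal_tail_inequality:
  fixes G :: "real \<Rightarrow> real"
  assumes G0: "G 0 = 1"
    and cont: "continuous_on {0..} G"
    and deriv: "\<And>s. s > 0 \<Longrightarrow> (G has_real_derivative - sqrt (2 / pi) * exp (- s\<^sup>2 / 2)) (at s)"
    and lim: "(G \<longlongrightarrow> 0) at_top"
    and nonneg: "\<And>s. 0 \<le> G s"
    and s: "0 \<le> s"
  shows "exp (- 2 * s\<^sup>2) \<le> G s + sqrt (pi / 2) * s * G (2 * s)"
proof -
  define k c where "k = sqrt (pi / 2)" and "c = sqrt (2 / pi)"
  have k0: "k > 0" by (simp add: k_def)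
  have kc: "k * c = 1" by (simp add: k_def c_def real_sqrt_mult[symmetric])
  have ck: "c < k"
  proof -
    have "2 / pi < 1" "1 < pi / 2" using pi_gt3 by auto
    then show ?thesis unfolding k_def c_def by (intro real_sqrt_less_mono) linarith
  qed
  define D where "D = (\<lambda>s. G s + k * s * G (2 * s) - exp (- 2 * s\<^sup>2))"
  \<comment> \<open>\<open>E\<close> is the derivative of \<open>D\<close>, and \<open>q\<close> carries the sign of the derivative of \<open>E\<close>.\<close>
  define E where "E = (\<lambda>s. k * G (2 * s) + 2 * s * exp (- 2 * s\<^sup>2) - c * exp (- s\<^sup>2 / 2))"
  define q where "q = (\<lambda>s. c - 8 * (s * exp (- 3/2 * s\<^sup>2)))"
  have deriv2: "((\<lambda>s. G (2 * s)) has_real_derivative - 2 * c * exp (- 2 * s\<^sup>2)) (at s)"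
    if "s > 0" for s
  proof -
    have "((\<lambda>s. G (2 * s)) has_real_derivative - c * exp (- (2 * s)\<^sup>2 / 2) * 2) (at s)"
      using that by (intro DERIV_chain2[OF deriv[folded c_def]])
        (auto intro!: derivative_eq_intros)
    then show ?thesis by (simp add: power_mult_distrib mult_ac)
  qed
  have cont2: "continuous_on {0..} (\<lambda>s. G (2 * s))"
    by (intro continuous_on_compose2[OF cont] continuous_intros) auto
  have Dcont: "continuous_on {0..} D" unfolding D_def by (intro continuous_intros cont cont2)
  have Econt: "continuous_on {0..} E" unfolding E_def by (intro continuous_intros cont cont2) auto
  have D': "(D has_real_derivative E s) (at s)" if "s > 0" for s
  proof -
    have "(D has_real_derivative (- c * exp (- s\<^sup>2 / 2) +
        (k * G (2 * s) + k * s * (- 2 * c * exp (- 2 * s\<^sup>2))) + 4 * s * exp (- 2 * s\<^sup>2))) (at s)"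
      unfolding D_def
      by (rule derivative_eq_intros deriv[folded c_def] deriv2 that refl | simp)+
    moreover have eq: "k * s * (- 2 * c * exp (- 2 * s\<^sup>2)) = - 2 * s * exp (- 2 * s\<^sup>2)"
      using kc by algebra
    ultimately show ?thesis unfolding eq E_def by (simp add: algebra_simps)
  qed
  have E': "(E has_real_derivative s * exp (- s\<^sup>2 / 2) * q s) (at s)" if "s > 0" for s
  proof -
    have "(E has_real_derivative (k * (- 2 * c * exp (- 2 * s\<^sup>2)) +
        (2 * exp (- 2 * s\<^sup>2) - 8 * s * s * exp (- 2 * s\<^sup>2)) + c * s * exp (- s\<^sup>2 / 2))) (at s)"
      unfolding E_def
      by (rule derivative_eq_intros deriv2 that refl | simp add: algebra_simps)+
    moreover have eq: "k * (- 2 * c * exp (- 2 * s\<^sup>2)) = - 2 * exp (- 2 * s\<^sup>2)"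
      using kc by algebra
    moreover have exp_eq: "exp (- 2 * s\<^sup>2) = exp (- s\<^sup>2 / 2) * exp (- 3/2 * s\<^sup>2)"
      by (simp add: exp_add[symmetric])
    ultimately show ?thesis unfolding eq unfolding exp_eq q_def by (simp add: algebra_simps)
  qed
  have E0: "E 0 > 0" using ck by (simp add: E_def G0)
  have lim2: "((\<lambda>s. G (2 * s)) \<longlongrightarrow> 0) at_top"
    by (rule filterlim_compose[OF lim]) real_asymp
  have Elim: "(E \<longlongrightarrow> 0) at_top"
  proof -
    have "((\<lambda>s. 2 * s * exp (- 2 * s\<^sup>2) - c * exp (- s\<^sup>2 / 2)) \<longlongrightarrow> 0) at_top"
      by real_asymp
    from tendsto_add[OF tendsto_mult_left[OF lim2, of k] this] show ?thesis
      by (simp add: E_def algebra_simps)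
  qed
  have E_mvt: "\<exists>z. a < z \<and> z < b \<and> (E a < E b \<longrightarrow> 0 < q z) \<and> (E b < E a \<longrightarrow> q z < 0)"
    if "0 \<le> a" "a < b" for a b
  proof -
    have "\<exists>l z. a < z \<and> z < b \<and> DERIV E z :> l \<and> E b - E a = (b - a) * l"
    proof (rule MVT[OF that(2)])
      show "continuous_on {a..b} E" using that by (intro continuous_on_subset[OF Econt]) auto
      show "E differentiable (at x)" if "a < x" "x < b" for x
        using E'[of x] that \<open>0 \<le> a\<close> by (auto simp: real_differentiable_def)
    qed
    then obtain l z where z: "a < z" "z < b" "DERIV E z :> l" "E b - E a = (b - a) * l" by blast
    define w where "w = (b - a) * (z * exp (- z\<^sup>2 / 2))"
    have "l = z * exp (- z\<^sup>2 / 2) * q z"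
      using DERIV_unique[OF z(3) E'] z that by simp
    then have "E b = E a + w * q z" using z by (simp add: w_def)
    moreover have "w > 0" using that z by (simp add: w_def)
    ultimately have "(E a < E b \<longrightarrow> 0 < q z) \<and> (E b < E a \<longrightarrow> q z < 0)"
      by (simp add: zero_less_mult_iff mult_less_0_iff)
    then show ?thesis using z by blast
  qed
  have crossing: "E t \<le> 0" if r: "0 \<le> r" "E r < 0" "r < t" for r t
  proof (rule ccontr)
    assume "\<not> E t \<le> 0"
    then have t: "E t > 0" by simp
    \<comment> \<open>Since \<open>E\<close> tends to 0, some \<open>u > t\<close> has \<open>E u < E t\<close>; with \<open>E 0 > E r < E t\<close> the mean value
        theorem yields a negative, a positive and a negative value of \<open>q\<close>, in this order.\<close>
    have "\<forall>\<^sub>F u in at_top. E u < E t \<and> u > t"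
      using order_tendstoD(2)[OF Elim t] eventually_gt_at_top by (rule eventually_conj)
    from eventually_happens'[OF trivial_limit_at_top_linorder this]
    obtain u where u: "E u < E t" "u > t" by blast
    have "r > 0" using r E0 by (cases "r = 0") auto
    moreover have "E r < E 0" using r E0 by simp
    ultimately obtain x where x: "0 < x" "x < r" "q x < 0"
      using E_mvt[of 0 r] by blast
    have "E r < E t" using r t by simp
    then obtain y where y: "r < y" "y < t" "q y > 0"
      using E_mvt[of r t] r by blast
    have "0 \<le> t" using r by simp
    then obtain z where z: "t < z" "z < u" "q z < 0"
      using E_mvt[of t u] u by blast
    show False
      using gaussian_times_id_quasiconcave[of x y z] x y z unfolding q_def by auto
  qed
  have "D s \<ge> 0"
  proof (cases "\<forall>r. 0 < r \<and> r < s \<longrightarrow> E r \<ge> 0")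
    case True
    have "D 0 \<le> D s"
    proof (rule DERIV_nonneg_imp_increasing_open[OF s])
      show "\<exists>y. (D has_real_derivative y) (at x) \<and> 0 \<le> y" if "0 < x" "x < s" for x
        using D'[of x] True that by blast
      show "continuous_on {0..s} D" by (rule continuous_on_subset[OF Dcont]) auto
    qed
    then show ?thesis by (simp add: D_def G0)
  next
    case False
    then obtain r where r: "0 < r" "r < s" "E r < 0" by force
    \<comment> \<open>From \<open>s\<close> onwards \<open>D\<close> decreases, so \<open>D s\<close> dominates every lower bound of a later value.\<close>
    have "- exp (- 2 * t\<^sup>2) \<le> D s" if "t \<ge> s" for t
    proof -
      have "D t \<le> D s"
      proof (rule DERIV_nonpos_imp_decreasing_open[OF that])
        show "\<exists>y. (D has_real_derivative y) (at x) \<and> y \<le> 0" if "s < x" "x < t" for x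
          using D'[of x] crossing[of r x] r that by (intro exI[of _ "E x"]) auto
        show "continuous_on {s..t} D" using s by (intro continuous_on_subset[OF Dcont]) auto
      qed
      moreover have "- exp (- 2 * t\<^sup>2) \<le> D t"
        using nonneg[of t] nonneg[of "2 * t"] k0 that s by (simp add: D_def)
      ultimately show ?thesis by simp
    qed
    then have "\<forall>\<^sub>F t in at_top. - exp (- 2 * t\<^sup>2) \<le> D s"
      by (auto intro: eventually_mono[OF eventually_ge_at_top[of s]])
    moreover have "((\<lambda>t::real. - exp (- 2 * t\<^sup>2)) \<longlongrightarrow> 0) at_top" by real_asymp
    ultimately show ?thesis
      by (intro tendsto_upperbound) auto
  qed
  then show ?thesis by (simp add: D_def k_def)
qed

section \<open>Densities and tails of chi-square distributions\<close>

lemma chi_square_density_1: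
  "x > 0 \<Longrightarrow> chi_square_density 1 x = exp (- x / 2) / (sqrt (2 * pi) * sqrt x)"
  using powr_half_sqrt[of x] powr_half_sqrt[of 2] powr_minus[of x "1 / 2"] Gamma_one_half_real
  by (simp add: chi_square_density_def real_sqrt_mult divide_simps)

lemma chi_square_density_4:
  "chi_square_density 4 x = (if x > 0 then x * exp (- x / 2) / 4 else 0)"
  by (simp add: chi_square_density_def Gamma_numeral)

lemma chi_square_density_nonneg: "d > 0 \<Longrightarrow> chi_square_density d x \<ge> 0"
  by (simp add: chi_square_density_def Gamma_real_nonneg)

lemma density_tail_has_real_derivative:
  fixes f :: "real \<Rightarrow> real"
  assumes [measurable]: "f \<in> borel_measurable borel"
    and nonneg: "\<And>x. 0 \<le> f x"
    and prob: "prob_space (density lborel f)"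
    and cont: "continuous_on {a..b} f"
    and x: "a < x" "x < b"
  shows "((\<lambda>y. measure (density lborel f) {y<..}) has_real_derivative - f x) (at x)"
proof -
  interpret prob_space "density lborel f" by fact
  define \<mu> where "\<mu> = density lborel (\<lambda>x. ennreal (f x))"
  have *: "measure \<mu> {y<..} = measure \<mu> {a<..} - integral {a..y} f" if y: "y \<in> {a<..<b}" for y
  proof -
    have c: "continuous_on {a..y} f" using y by (intro continuous_on_subset[OF cont]) auto
    have i: "(f has_integral integral {a..y} f) {a..y}"
      by (intro integrable_integral integrable_continuous_interval c)
    have "emeasure \<mu> {a<..y} = (\<integral>\<^sup>+u. ennreal (f u) * indicator {a<..y} u \<partial>lborel)"
      unfolding \<mu>_def by (subst emeasure_density) auto
    also have "\<dots> = (\<integral>\<^sup>+u. ennreal (f u) * indicator {a..y} u \<partial>lborel)"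
      by (intro nn_integral_cong_AE AE_I[where N="{a}"]) (auto split: split_indicator)
    also have "\<dots> = ennreal (integral {a..y} f)"
      using nn_integral_has_integral_lebesgue[OF nonneg i]
      by (simp add: nn_integral_set_ennreal mult.commute)
    finally have "measure \<mu> {a<..y} = integral {a..y} f"
      by (simp add: measure_def integral_nonneg[OF integrable_continuous_interval[OF c]] nonneg)
    moreover have "measure \<mu> {a<..} = measure \<mu> {a<..y} + measure \<mu> {y<..}"
    proof -
      have "{a<..} = {a<..y} \<union> {y<..}" using y by auto
      then show ?thesis unfolding \<mu>_def
        by (simp add: finite_measure_Union[symmetric] ivl_disj_int)
    qed
    ultimately show ?thesis by simp
  qed
  have "((\<lambda>y. measure \<mu> {a<..} - integral {a..y} f) has_real_derivative 0 - f x) (at x within {a..b})"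
    using x by (intro DERIV_diff DERIV_const integral_has_real_derivative cont) auto
  then have "((\<lambda>y. measure \<mu> {a<..} - integral {a..y} f) has_real_derivative - f x) (at x)"
    using x at_within_Icc_at[of a x b] by simp
  then show ?thesis unfolding \<mu>_def[symmetric]
    by (rule has_field_derivative_transform_within_open[of _ _ _ "{a<..<b}"]) (use x * in auto)
qed

lemma chi_square_tail_has_real_derivative:
  assumes "d > 0" "x > 0"
  shows "((\<lambda>y. measure (chi_square d) {y<..}) has_real_derivative - chi_square_density d x) (at x)"
  unfolding chi_square_def
proof (rule density_tail_has_real_derivative)
  have "Gamma (real d / 2) \<noteq> 0"
    using assms Gamma_real_pos[of "real d / 2"] by (metis half_gt_zero less_irrefl of_nat_0_less_iff)
  then have "continuous_on {x/2..2*x} (\<lambda>x. x powr (real d / 2 - 1) * exp (- x / 2) /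
        (2 powr (real d / 2) * Gamma (real d / 2)))"
    using assms
    by (intro continuous_on_divide continuous_on_mult continuous_on_powr continuous_on_exp
        continuous_on_const continuous_on_id continuous_on_minus) auto
  also have "?this \<longleftrightarrow> continuous_on {x/2..2*x} (chi_square_density d)"
    using assms by (intro continuous_on_cong) (auto simp: chi_square_density_def)
  finally show "continuous_on {x/2..2*x} (chi_square_density d)" .
  show "prob_space (density lborel (chi_square_density d))"
    using prob_space_chi_square[OF assms(1)] by (simp add: chi_square_def)
  show "0 \<le> chi_square_density d y" for y
    using assms(1) by (rule chi_square_density_nonneg)
qed (use assms(2) in auto)

lemma chi_square_tail_nonpos:
  assumes "d > 0" "t \<le> 0"
  shows "measure (chi_square d) {t<..} = 1"
proof -
  interpret prob_space "chi_square d" using prob_space_chi_square assms by simp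
  have "AE x in chi_square d. x \<in> {t<..}"
    unfolding chi_square_def using assms
    by (subst AE_density) (auto simp: chi_square_density_def)
  then show ?thesis
    by (subst prob_eq_1) auto
qed

lemma chi_square_real_distribution: "d > 0 \<Longrightarrow> real_distribution (chi_square d)"
  by (simp add: real_distribution_def real_distribution_axioms_def prob_space_chi_square)

lemma (in real_distribution) tail_eq_one_minus_cdf: "measure M {t<..} = 1 - cdf M t"
proof -
  have "{t<..} = space M - {..t}" by auto
  then show ?thesis using prob_compl[of "{..t}"] by (simp add: cdf_def)
qed

lemma chi_square_tail_tendsto_0:
  assumes "d > 0"
  shows "((\<lambda>t. measure (chi_square d) {t<..}) \<longlongrightarrow> 0) at_top"
proof -
  interpret real_distribution "chi_square d" using chi_square_real_distribution assms by simp
  show ?thesis unfolding tail_eq_one_minus_cdf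
    using tendsto_diff[OF tendsto_const[of 1] cdf_lim_at_top_prob] by simp
qed

text \<open>
  For \<open>d = 1\<close> the density is unbounded near 0, so continuity at 0 comes from the right-continuity of
  the distribution function and not from differentiability.
\<close>

lemma continuous_on_chi_square_tail:
  assumes "d > 0"
  shows "continuous_on {0..} (\<lambda>t. measure (chi_square d) {t<..})"
  unfolding continuous_on_eq_continuous_within
proof
  interpret real_distribution "chi_square d" using chi_square_real_distribution assms by simp
  fix x :: real assume x: "x \<in> {0..}"
  show "continuous (at x within {0..}) (\<lambda>t. measure (chi_square d) {t<..})"
  proof (cases "x = 0")
    case True
    have "continuous (at_right 0) (\<lambda>t. measure (chi_square d) {t<..})"
      unfolding tail_eq_one_minus_cdf by (intro continuous_intros cdf_is_right_cont)
    then show ?thesis using True by (simp add: continuous_within at_within_Ici_at_right)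
  next
    case False
    then have "x > 0" using x by simp
    then show ?thesis
      by (rule continuous_at_imp_continuous_at_within
          [OF DERIV_isCont[OF chi_square_tail_has_real_derivative[OF assms]]])
  qed
qed

text \<open>
  The square root of a variable with law \<open>chi_square 1\<close> is half-normal, so \<open>half_normal_tail_inequality\<close>
  applies to \<open>\<lambda>s. Q (s\<^sup>2)\<close>.
\<close>

lemma chi_square_1_tail_inequality:
  fixes s :: real
  defines "Q \<equiv> \<lambda>t. measure (chi_square 1) {t<..}"
  assumes "s \<ge> 0"
  shows "exp (- 2 * s\<^sup>2) \<le> Q (s\<^sup>2) + sqrt (pi / 2) * s * Q (4 * s\<^sup>2)"
proof -
  have "exp (- 2 * s\<^sup>2) \<le> Q (s\<^sup>2) + sqrt (pi / 2) * s * Q ((2 * s)\<^sup>2)"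
  proof (rule half_normal_tail_inequality)
    show "Q (0\<^sup>2) = 1" by (simp add: Q_def chi_square_tail_nonpos)
    show "continuous_on {0..} (\<lambda>s. Q (s\<^sup>2))"
      unfolding Q_def
      by (rule continuous_on_compose2[OF continuous_on_chi_square_tail]) (auto intro!: continuous_intros)
    show "((\<lambda>s. Q (s\<^sup>2)) \<longlongrightarrow> 0) at_top"
      unfolding Q_def
      by (rule filterlim_compose[OF chi_square_tail_tendsto_0]) (simp, real_asymp)
    show "((\<lambda>s. Q (s\<^sup>2)) has_real_derivative - sqrt (2 / pi) * exp (- u\<^sup>2 / 2)) (at u)"
      if u: "u > 0" for u
    proof -
      have "((\<lambda>s. Q (s\<^sup>2)) has_real_derivative - chi_square_density 1 (u\<^sup>2) * (2 * u)) (at u)"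
        unfolding Q_def
        by (rule DERIV_chain2[OF chi_square_tail_has_real_derivative])
          (use u in \<open>auto intro!: derivative_eq_intros\<close>)
      moreover have "chi_square_density 1 (u\<^sup>2) * (2 * u) = sqrt (2 / pi) * exp (- u\<^sup>2 / 2)"
        using u by (subst chi_square_density_1) (simp_all add: real_sqrt_mult real_sqrt_divide field_simps)
      ultimately show ?thesis by simp
    qed
  qed (use assms in \<open>auto simp: Q_def\<close>)
  then show ?thesis by (simp add: power_mult_distrib)
qed

section \<open>The tail of the product\<close>

text \<open>
  On the right-hand side \<open>ennreal\<close> truncates negative reals to 0, which gives the correct probability
  when \<open>x < 4 * s\<^sup>2\<close>.
\<close>

lemma uniform_square_tail:
  fixes s x :: real
  assumes s: "s > 0" and x: "x > 0"
  shows "emeasure (uniform_measure lborel {0..1}) {u. s\<^sup>2 < 1 / 4 * x * u\<^sup>2}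
    = ennreal (1 - 2 * s / sqrt x)"
proof -
  have *: "s\<^sup>2 < 1 / 4 * x * u\<^sup>2 \<longleftrightarrow> 2 * s / sqrt x < u" if "0 \<le> u" for u
  proof -
    have "s\<^sup>2 < 1 / 4 * x * u\<^sup>2 \<longleftrightarrow> (2 * s)\<^sup>2 < (sqrt x * u)\<^sup>2"
      using x by (auto simp: power_mult_distrib)
    also have "\<dots> \<longleftrightarrow> 2 * s < sqrt x * u"
      using power2_less_imp_less[of "2 * s" "sqrt x * u"] power_strict_mono[of "2 * s" "sqrt x * u" 2]
        s x that by (metis less_imp_le mult_nonneg_nonneg pos2 real_sqrt_ge_zero zero_le_numeral)
    finally show ?thesis using x by (simp add: field_simps)
  qed
  define v where "v = 2 * s / sqrt x"
  have v: "v > 0" using s x by (simp add: v_def)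
  have "{0..1} \<inter> {u. s\<^sup>2 < 1 / 4 * x * u\<^sup>2} = {v<..1}"
  proof (rule set_eqI)
    fix u
    show "u \<in> {0..1} \<inter> {u. s\<^sup>2 < 1 / 4 * x * u\<^sup>2} \<longleftrightarrow> u \<in> {v<..1}"
      using *[of u, folded v_def] v by (cases "0 \<le> u") auto
  qed
  then have "emeasure (uniform_measure lborel {0..1}) {u. s\<^sup>2 < 1 / 4 * x * u\<^sup>2}
      = emeasure lborel {v<..1}"
    by (subst emeasure_uniform_measure) (auto simp: divide_ennreal_def)
  also have "\<dots> = ennreal (1 - v)"
    by (cases "v \<le> 1") (auto simp: ennreal_neg)
  finally show ?thesis by (simp add: v_def)
qed

lemma nn_integral_chi_square_4_uniform_tail:
  fixes s :: real
  assumes s: "s > 0"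
  shows "(\<integral>\<^sup>+x. ennreal (chi_square_density 4 x) * ennreal (1 - 2 * s / sqrt x) \<partial>lborel)
    = ennreal (exp (- 2 * s\<^sup>2) - sqrt (pi / 2) * s * measure (chi_square 1) {4 * s\<^sup>2<..})"
proof -
  define Q where "Q = (\<lambda>t. measure (chi_square 1) {t<..})"
  define f where "f = (\<lambda>x::real. (x - 2 * s * sqrt x) * exp (- x / 2) / 4)"
  \<comment> \<open>\<open>F\<close> is an antiderivative of \<open>f\<close> that vanishes at infinity. Integrating \<open>sqrt x * exp (- x / 2)\<close>
      by parts leaves a multiple of the density of \<open>chi_square 1\<close>, hence the term with \<open>Q\<close>.\<close>
  define F where "F = (\<lambda>x::real. - (x + 2) / 2 * exp (- x / 2) + s * sqrt x * exp (- x / 2)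
      + s * sqrt (pi / 2) * Q x)"
  have iff: "4 * s\<^sup>2 \<le> x \<longleftrightarrow> 2 * s \<le> sqrt x" if "x > 0" for x
    using s that real_le_rsqrt[of "2 * s" x] sqrt_ge_absD[of "2 * s" x]
    by (auto simp: power_mult_distrib)
  have pos: "x > 0" if "4 * s\<^sup>2 \<le> x" for x
    using s that by (smt (verit) zero_less_power)
  have "(\<integral>\<^sup>+x. ennreal (chi_square_density 4 x) * ennreal (1 - 2 * s / sqrt x) \<partial>lborel)
      = (\<integral>\<^sup>+x. ennreal (f x) * indicator {4 * s\<^sup>2..} x \<partial>lborel)"
  proof (rule nn_integral_cong)
    fix x :: real
    show "ennreal (chi_square_density 4 x) * ennreal (1 - 2 * s / sqrt x)
        = ennreal (f x) * indicator {4 * s\<^sup>2..} x"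
    proof (cases "4 * s\<^sup>2 \<le> x")
      case True
      have "x / sqrt x = sqrt x" using pos[OF True] by (simp add: real_div_sqrt)
      then have "chi_square_density 4 x * (1 - 2 * s / sqrt x) = f x"
        using pos[OF True] by (simp add: chi_square_density_4 f_def field_simps)
      then show ?thesis using True pos[OF True] iff[of x]
        by (simp add: ennreal_mult'[symmetric] chi_square_density_nonneg)
    next
      case False
      then show ?thesis using iff[of x]
        by (cases "x > 0") (auto simp: chi_square_density_4 ennreal_neg field_simps)
    qed
  qed
  also have "\<dots> = 0 - F (4 * s\<^sup>2)"
  proof (rule nn_integral_FTC_atLeast)
    show "f \<in> borel_measurable borel" unfolding f_def by measurable
    show "0 \<le> f x" if x: "4 * s\<^sup>2 \<le> x" for x
    proof -
      have "2 * s * sqrt x \<le> sqrt x * sqrt x"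
        using iff[of x] pos[OF x] x by (intro mult_right_mono) auto
      then show ?thesis using pos[OF x] by (simp add: f_def)
    qed
    show "(F has_real_derivative f x) (at x)" if "4 * s\<^sup>2 \<le> x" for x
    proof -
      have x: "x > 0" using pos that .
      have dQ: "(Q has_real_derivative - chi_square_density 1 x) (at x)"
        unfolding Q_def by (rule chi_square_tail_has_real_derivative) (use x in auto)
      have "(F has_real_derivative (- 1 / 2 * exp (- x / 2) + (x + 2) / 4 * exp (- x / 2)
          + (s * (inverse (sqrt x) / 2) * exp (- x / 2) - s * sqrt x * exp (- x / 2) / 2)
          - s * (sqrt (pi / 2) * chi_square_density 1 x))) (at x)"
        unfolding F_def using x
        by (auto intro!: derivative_eq_intros dQ simp: field_simps)
      then show ?thesis
      proof (rule DERIV_cong)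
        have eq: "sqrt (pi / 2) * chi_square_density 1 x = inverse (sqrt x) / 2 * exp (- x / 2)"
          using x by (subst chi_square_density_1)
            (simp_all add: real_sqrt_mult real_sqrt_divide exp_minus field_simps)
        show "- 1 / 2 * exp (- x / 2) + (x + 2) / 4 * exp (- x / 2)
            + (s * (inverse (sqrt x) / 2) * exp (- x / 2) - s * sqrt x * exp (- x / 2) / 2)
            - s * (sqrt (pi / 2) * chi_square_density 1 x) = f x"
          unfolding eq by (simp add: f_def algebra_simps)
      qed
    qed
    have "((\<lambda>x::real. - (x + 2) / 2 * exp (- x / 2) + s * sqrt x * exp (- x / 2)) \<longlongrightarrow> 0) at_top"
      by real_asymp
    from tendsto_add[OF this tendsto_mult_left[OF chi_square_tail_tendsto_0[of 1]]]
    show "(F \<longlongrightarrow> 0) at_top" by (simp add: F_def Q_def)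
  qed
  also have "0 - F (4 * s\<^sup>2) = exp (- 2 * s\<^sup>2) - sqrt (pi / 2) * s * Q (4 * s\<^sup>2)"
  proof -
    have sqrt_eq: "sqrt (4 * s\<^sup>2) = 2 * s" using s by (simp add: real_sqrt_mult)
    show ?thesis unfolding F_def sqrt_eq by (simp add: field_simps power2_eq_square)
  qed
  finally show ?thesis unfolding Q_def .
qed

lemma chi_square_4_times_uniform_square_tail:
  fixes M :: "'a measure" and X U :: "'a \<Rightarrow> real"
  assumes "prob_space M"
    and X: "distr M borel X = chi_square 4"
    and U: "distr M borel U = uniform_measure lborel {0..1}"
    and indep: "prob_space.indep_var M borel X borel U"
    and s: "s > 0"
  shows "emeasure (distr M borel (\<lambda>\<omega>. 1 / 4 * X \<omega> * (U \<omega>)\<^sup>2)) {s\<^sup>2<..}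
    = ennreal (exp (- 2 * s\<^sup>2) - sqrt (pi / 2) * s * measure (chi_square 1) {4 * s\<^sup>2<..})"
proof -
  interpret prob_space M by fact
  interpret unif: prob_space "uniform_measure lborel {0..1::real}"
    by (rule prob_space_uniform_measure) auto
  have [measurable]: "random_variable borel X" "random_variable borel U"
    and joint: "distr M borel X \<Otimes>\<^sub>M distr M borel U = distr M (borel \<Otimes>\<^sub>M borel) (\<lambda>\<omega>. (X \<omega>, U \<omega>))"
    using indep unfolding indep_var_distribution_eq by auto
  define A where "A = {p :: real \<times> real. s\<^sup>2 < 1 / 4 * fst p * (snd p)\<^sup>2}"
  have "(\<lambda>p::real \<times> real. 1 / 4 * fst p * (snd p)\<^sup>2) \<in> borel_measurable (borel \<Otimes>\<^sub>M borel)"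
    by measurable
  then have "(\<lambda>p::real \<times> real. 1 / 4 * fst p * (snd p)\<^sup>2) -` {s\<^sup>2<..} \<inter> space (borel \<Otimes>\<^sub>M borel)
      \<in> sets (borel \<Otimes>\<^sub>M borel)"
    by (rule measurable_sets) simp
  also have "(\<lambda>p::real \<times> real. 1 / 4 * fst p * (snd p)\<^sup>2) -` {s\<^sup>2<..} \<inter> space (borel \<Otimes>\<^sub>M borel) = A"
    by (auto simp: A_def space_pair_measure)
  finally have A[measurable]: "A \<in> sets (borel \<Otimes>\<^sub>M borel)" .
  have "emeasure (distr M borel (\<lambda>\<omega>. 1 / 4 * X \<omega> * (U \<omega>)\<^sup>2)) {s\<^sup>2<..}
      = emeasure (distr M (borel \<Otimes>\<^sub>M borel) (\<lambda>\<omega>. (X \<omega>, U \<omega>))) A"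
  proof -
    have "emeasure (distr M (borel \<Otimes>\<^sub>M borel) (\<lambda>\<omega>. (X \<omega>, U \<omega>))) A
        = emeasure M ((\<lambda>\<omega>. (X \<omega>, U \<omega>)) -` A \<inter> space M)"
      by (rule emeasure_distr[OF _ A]) measurable
    also have "(\<lambda>\<omega>. (X \<omega>, U \<omega>)) -` A = (\<lambda>\<omega>. 1 / 4 * X \<omega> * (U \<omega>)\<^sup>2) -` {s\<^sup>2<..}"
      by (auto simp: A_def)
    also have "emeasure M ((\<lambda>\<omega>. 1 / 4 * X \<omega> * (U \<omega>)\<^sup>2) -` {s\<^sup>2<..} \<inter> space M)
        = emeasure (distr M borel (\<lambda>\<omega>. 1 / 4 * X \<omega> * (U \<omega>)\<^sup>2)) {s\<^sup>2<..}"
      by (rule emeasure_distr[symmetric]) measurable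
    finally show ?thesis ..
  qed
  also have "\<dots> = emeasure (chi_square 4 \<Otimes>\<^sub>M uniform_measure lborel {0..1}) A"
    unfolding joint[symmetric] X U ..
  also have "\<dots> = (\<integral>\<^sup>+x. emeasure (uniform_measure lborel {0..1}) (Pair x -` A) \<partial>chi_square 4)"
  proof (rule unif.emeasure_pair_measure_alt)
    have "sets (chi_square 4 \<Otimes>\<^sub>M uniform_measure lborel {0..1}) = sets (borel \<Otimes>\<^sub>M borel :: (real \<times> real) measure)"
      by (rule sets_pair_measure_cong) auto
    then show "A \<in> sets (chi_square 4 \<Otimes>\<^sub>M uniform_measure lborel {0..1})" using A by blast
  qed
  also have "\<dots> = (\<integral>\<^sup>+x. ennreal (chi_square_density 4 x)
      * emeasure (uniform_measure lborel {0..1}) (Pair x -` A) \<partial>lborel)"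
    unfolding chi_square_def
  proof (rule nn_integral_density)
    have "sets (lborel \<Otimes>\<^sub>M uniform_measure lborel {0..1}) = sets (borel \<Otimes>\<^sub>M borel :: (real \<times> real) measure)"
      by (rule sets_pair_measure_cong) auto
    then show "(\<lambda>x. emeasure (uniform_measure lborel {0..1}) (Pair x -` A)) \<in> borel_measurable lborel"
      using A by (intro unif.measurable_emeasure_Pair) blast
  qed measurable
  also have "\<dots> = (\<integral>\<^sup>+x. ennreal (chi_square_density 4 x) * ennreal (1 - 2 * s / sqrt x) \<partial>lborel)"
  proof (rule nn_integral_cong)
    fix x :: real
    show "ennreal (chi_square_density 4 x) * emeasure (uniform_measure lborel {0..1}) (Pair x -` A)
        = ennreal (chi_square_density 4 x) * ennreal (1 - 2 * s / sqrt x)"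
      using uniform_square_tail[OF s, of x]
      by (cases "x > 0") (auto simp: A_def chi_square_density_4 vimage_def)
  qed
  finally show ?thesis using nn_integral_chi_square_4_uniform_tail[OF s] by simp
qed

theorem proposition4p3:
  fixes M :: "'a measure" and R U :: "'a \<Rightarrow> real"
  assumes "prob_space M"
    and "distr M borel (\<lambda>\<omega>. (R \<omega>)\<^sup>2) = chi_square 4"
    and "distr M borel U = uniform_measure lborel {0..1}"
    and "prob_space.indep_var M borel (\<lambda>\<omega>. (R \<omega>)\<^sup>2) borel U"
  shows "distr M borel (\<lambda>\<omega>. 1 / 4 * (R \<omega>)\<^sup>2 * (U \<omega>)\<^sup>2) \<le>\<^sub>s\<^sub>t chi_square 1"
  unfolding stochastic_le_def
proof
  fix t :: real
  interpret prob_space M by fact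
  have [measurable]: "random_variable borel (\<lambda>\<omega>. (R \<omega>)\<^sup>2)" "random_variable borel U"
    using assms(4) unfolding indep_var_distribution_eq by auto
  interpret V: prob_space "distr M borel (\<lambda>\<omega>. 1 / 4 * (R \<omega>)\<^sup>2 * (U \<omega>)\<^sup>2)"
    by (rule prob_space_distr) measurable
  show "measure (distr M borel (\<lambda>\<omega>. 1 / 4 * (R \<omega>)\<^sup>2 * (U \<omega>)\<^sup>2)) {t<..}
      \<le> measure (chi_square 1) {t<..}"
  proof (cases "t > 0")
    case False
    \<comment> \<open>All of the mass of \<open>chi_square 1\<close> is on the positive half-line, so its tail at \<open>t\<close> is 1.\<close>
    then have eq: "measure (chi_square 1) {t<..} = 1" by (intro chi_square_tail_nonpos) auto
    show ?thesis unfolding eq by (rule V.prob_le_1)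
  next
    case True
    define s where "s = sqrt t"
    have s: "s > 0" "t = s\<^sup>2" using True by (auto simp: s_def)
    show ?thesis
      unfolding s(2) measure_def[of "distr M borel _"]
    proof (rule enn2real_leI)
      have "exp (- 2 * s\<^sup>2) - sqrt (pi / 2) * s * measure (chi_square 1) {4 * s\<^sup>2<..}
          \<le> measure (chi_square 1) {s\<^sup>2<..}"
        using chi_square_1_tail_inequality[of s] s(1) by simp
      then show "emeasure (distr M borel (\<lambda>\<omega>. 1 / 4 * (R \<omega>)\<^sup>2 * (U \<omega>)\<^sup>2)) {s\<^sup>2<..}
          \<le> ennreal (measure (chi_square 1) {s\<^sup>2<..})"
        unfolding chi_square_4_times_uniform_square_tail[OF assms s(1)] by (rule ennreal_leI)
    qed simp
  qed
qed

end
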